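(* Let $\mathbb{F}$ be an algebraically closed field of characteristic zero, let $\phi,\varphi$ be two $\mathbb{F}$-automorphisms of the rational function field $\mathbb{F}(x,y)$, and fix arbitrary extensions of $\phi,\varphi$ to automorphisms of the algebraic closure $\overline{\mathbb{F}(x,y)}$ (still denoted $\phi,\varphi$). Let $f\in\mathbb{F}(x,y)$. Then there exist $g,h\in\overline{\mathbb{F}(x,y)}$ with $f=\phi(g)-g+\varphi(h)-h$ if and only if there exist $g,h\in\mathbb{F}(x,y)$ with $f=\phi(g)-g+\varphi(h)-h$. *)

theory Defs
  imports "HOL-Algebra.Algebraic_Closure_Type"
begin

text \<open>
  The rational function field \<open>F(x,y)\<close>, as the fraction field of \<open>F[x][y]\<close>.  Its algebraic
  closure is the type \<open>'k ratfun2 alg_closure\<close>, with embedding \<open>to_ac\<close>.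
\<close>

type_synonym 'k ratfun2 = "'k poly poly fract"

definition ratfun2_const :: "'k :: field \<Rightarrow> 'k ratfun2"
  where "ratfun2_const c = to_fract [:[:c:]:]"

definition field_auts :: "('a :: field \<Rightarrow> 'a) set"
  where "field_auts = ring_iso (ring_of_type_algebra :: 'a ring) ring_of_type_algebra"

lemma field_auts_iff:
  "\<sigma> \<in> field_auts \<longleftrightarrow>
     bij \<sigma> \<and> (\<forall>a b. \<sigma> (a + b) = \<sigma> a + \<sigma> b) \<and> (\<forall>a b. \<sigma> (a * b) = \<sigma> a * \<sigma> b) \<and> \<sigma> 1 = 1"
  by (auto simp: field_auts_def ring_iso_def ring_hom_def ring_of_type_algebra_def)

definition const_field_auts :: "('k :: field ratfun2 \<Rightarrow> 'k ratfun2) set"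
  where "const_field_auts =
    {\<sigma> \<in> field_auts. \<forall>c. \<sigma> (ratfun2_const c) = ratfun2_const c}"

definition ac_extensions :: "('a :: field \<Rightarrow> 'a) \<Rightarrow> ('a alg_closure \<Rightarrow> 'a alg_closure) set"
  where "ac_extensions \<sigma> = {\<tau> \<in> field_auts. \<forall>a. \<tau> (to_ac a) = to_ac (\<sigma> a)}"

end

theory Submission
  imports Defs
begin

text \<open>
  Let \<open>K = F(x,y)\<close>.  The normalized trace \<open>T(a) = tr(a | L) / [L : K]\<close>, where \<open>L\<close> is any
  finite extension of \<open>K\<close> containing \<open>a\<close>, is independent of \<open>L\<close>: as a vector space over \<open>K(a)\<close>,
  \<open>L\<close> is a sum of copies of \<open>K(a)\<close>.  Hence \<open>T\<close> is an additive retraction of the algebraic closure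
  onto \<open>K\<close>.  An extension \<open>\<tau>\<close> of an automorphism \<open>\<sigma>\<close> of \<open>K\<close> carries \<open>L\<close> to \<open>\<tau>(L)\<close>
  semilinearly, so \<open>T \<circ> \<tau> = \<sigma> \<circ> T\<close>.  Applying \<open>T\<close> to a solution over the algebraic closure
  therefore gives a solution over \<open>K\<close>.
\<close>

section \<open>Algebraic extensions as vector spaces over the base field\<close>

text \<open>The two fields are different types, so the inclusion is an explicit homomorphism
  \<open>h\<close>. Algebraicity supplies finite-dimensional subalgebras; characteristic 0 allows
  division by their dimensions.\<close>

locale algebraic_extension =
  fixes h :: "'a :: field \<Rightarrow> 'b :: field"
  assumes hom_add: "h (x + y) = h x + h y"
    and hom_mult: "h (x * y) = h x * h y"
    and hom_1: "h 1 = 1"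
    and algebraic: "\<exists>p. p \<noteq> 0 \<and> poly (map_poly h p) z = 0"
    and char_0: "CHAR('a) = 0"
begin

lemma hom_0: "h 0 = 0"
  using hom_add[of 0 0] by (simp only: add_0_right add_cancel_right_right)

lemma hom_eq_0_iff: "h x = 0 \<longleftrightarrow> x = 0"
  by (metis hom_0 hom_1 hom_mult mult_zero_left right_inverse zero_neq_one)

lemma of_nat_neq_0: "n \<noteq> 0 \<Longrightarrow> of_nat n \<noteq> (0 :: 'a)"
  by (simp add: of_nat_eq_0_iff_char_dvd char_0)

definition scal :: "'a \<Rightarrow> 'b \<Rightarrow> 'b" (infixr "\<cdot>" 75)
  where "c \<cdot> x = h c * x"

sublocale vector_space scal
  by standard (simp_all add: scal_def hom_add hom_mult hom_1 algebra_simps)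

lemma mult_scal_right: "x * (c \<cdot> y) = c \<cdot> (x * y)"
  and mult_scal_left: "(c \<cdot> x) * y = c \<cdot> (x * y)"
  by (simp_all add: scal_def mult_ac)

lemma linear_mult: "Vector_Spaces.linear scal scal ((*) x)"
  by (intro Vector_Spaces.linear_iff[THEN iffD2])
     (simp add: vector_space_axioms mult_scal_right ring_distribs)

text \<open>Bilinearity, by span induction in each factor. The target \<open>C\<close> is kept
  separate so that the lemma covers both algebras and modules over them.\<close>

lemma mult_in_span:
  assumes "x \<in> span A" "y \<in> span B" "\<And>x y. x \<in> A \<Longrightarrow> y \<in> B \<Longrightarrow> x * y \<in> span C"
  shows "x * y \<in> span C"
  using assms(1)
proof (induction rule: span_induct_alt)
  case (step c a z)
  have "a * y \<in> span C"
    using assms(2)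
  proof (induction rule: span_induct_alt)
    case (step d b w)
    then show ?case
      using assms(3)[OF \<open>a \<in> A\<close>, of b]
      by (simp add: ring_distribs mult_scal_right span_add span_scale)
  qed (simp add: span_zero)
  with step show ?case
    by (simp add: ring_distribs mult_scal_left span_add span_scale)
qed (simp add: span_zero)

section \<open>Finite subalgebras, which are intermediate fields\<close>

text \<open>A finite intermediate field is encoded by a basis: \<open>card B\<close> is its degree,
  and closure under inverses is automatic by \<open>inverse_in_span\<close>.\<close>

definition subalgebra_basis :: "'b set \<Rightarrow> bool" where
  "subalgebra_basis B \<longleftrightarrow> finite B \<and> independent B \<and> 1 \<in> span B \<and>
     (\<forall>x\<in>span B. \<forall>y\<in>span B. x * y \<in> span B)"

lemma card_subalgebra_basis: "subalgebra_basis B \<Longrightarrow> card B \<noteq> 0"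
  by (auto simp: subalgebra_basis_def)

lemma subalgebra_basis_exists:
  assumes "1 \<in> A" "\<And>x y. x \<in> A \<Longrightarrow> y \<in> A \<Longrightarrow> x * y \<in> A" "finite F" "A \<subseteq> span F"
  obtains B where "subalgebra_basis B" "span B = span A"
proof -
  obtain B where B: "B \<subseteq> A" "independent B" "A \<subseteq> span B"
    using maximal_independent_subset[of A] by blast
  have "finite B"
    using independent_span_bound[OF assms(3) B(2)] B(1) assms(4) by blast
  have span: "span B = span A"
    using B by (simp add: span_eq span_base subset_iff)
  have "x * y \<in> span B" if "x \<in> span B" "y \<in> span B" for x y
    using that unfolding span
    by (rule mult_in_span) (simp add: assms(2) span_base)
  then have "subalgebra_basis B"
    using \<open>finite B\<close> B assms(1) by (auto simp: subalgebra_basis_def)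
  then show thesis
    using span that by blast
qed

text \<open>A nonzero polynomial of degree \<open>n\<close> killing \<open>a\<close> expresses
  \<open>a ^ n\<close> through lower powers, its leading coefficient being invertible. Higher powers
  follow by strong induction.\<close>

lemma powers_in_finite_span:
  obtains n where "\<And>k. a ^ k \<in> span ((\<lambda>i. a ^ i) ` {..<n})"
proof -
  obtain p where p: "p \<noteq> 0" "poly (map_poly h p) a = 0"
    using algebraic by blast
  define n where "n = degree p"
  define c where "c = lead_coeff p"
  have c: "c \<noteq> 0"
    using p by (simp add: c_def)
  have deg: "degree (map_poly h p) = n"
    unfolding n_def by (rule degree_map_poly) (use p in \<open>simp add: hom_eq_0_iff\<close>)
  have "(\<Sum>i\<le>n. h (coeff p i) * a ^ i) = 0"
    using p(2) by (simp add: poly_altdef deg coeff_map_poly hom_0)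
  then have "(\<Sum>i<n. coeff p i \<cdot> a ^ i) + c \<cdot> a ^ n = 0"
    by (simp add: scal_def n_def c_def flip: lessThan_Suc_atMost)
  then have eq: "c \<cdot> a ^ n = (\<Sum>i<n. (- coeff p i) \<cdot> a ^ i)"
    by (simp add: sum_negf eq_neg_iff_add_eq_0 add.commute)
  have an: "a ^ n = (\<Sum>i<n. (- coeff p i / c) \<cdot> a ^ i)"
  proof -
    have "a ^ n = inverse c \<cdot> (c \<cdot> a ^ n)"
      using c by simp
    also have "\<dots> = (\<Sum>i<n. (- coeff p i / c) \<cdot> a ^ i)"
      unfolding eq by (simp add: scale_sum_right divide_inverse mult.commute)
    finally show ?thesis .
  qed
  have "a ^ k \<in> span ((\<lambda>i. a ^ i) ` {..<n})" for k
  proof (induction k rule: less_induct)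
    case (less k)
    show ?case
    proof (cases "k < n")
      case False
      then have "a ^ k = a ^ (k - n) * a ^ n"
        by (simp add: power_add[symmetric])
      also have "\<dots> = (\<Sum>i<n. (- coeff p i / c) \<cdot> a ^ (k - n + i))"
        unfolding an by (simp add: sum_distrib_left mult_scal_right power_add)
      also have "\<dots> \<in> span ((\<lambda>i. a ^ i) ` {..<n})"
        using False by (intro span_sum span_scale less.IH) auto
      finally show ?thesis .
    qed (simp add: span_base)
  qed
  then show thesis
    using that by blast
qed

text \<open>The monomials \<open>a ^ i * b ^ j\<close> are closed under multiplication, and those
  with bounded exponents span them all. Two elements are treated together for the sake of
  \<open>ntrace_add\<close>.\<close>

lemma subalgebra_basis_exists_containing:
  obtains B where "subalgebra_basis B" "a \<in> span B" "b \<in> span B"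
proof -
  obtain m where m: "\<And>k. a ^ k \<in> span ((\<lambda>i. a ^ i) ` {..<m})"
    using powers_in_finite_span by blast
  obtain n where n: "\<And>k. b ^ k \<in> span ((\<lambda>i. b ^ i) ` {..<n})"
    using powers_in_finite_span by blast
  define A where "A = range (\<lambda>(i, j). a ^ i * b ^ j)"
  define F where "F = (\<lambda>(i, j). a ^ i * b ^ j) ` ({..<m} \<times> {..<n})"
  have A: "a ^ i * b ^ j \<in> A" for i j
    by (auto simp: A_def)
  have "x * y \<in> A" if "x \<in> A" "y \<in> A" for x y
  proof -
    obtain i j k l where "x = a ^ i * b ^ j" "y = a ^ k * b ^ l"
      using \<open>x \<in> A\<close> \<open>y \<in> A\<close> by (auto simp: A_def)
    then have "x * y = a ^ (i + k) * b ^ (j + l)"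
      by (simp add: power_add mult_ac)
    then show ?thesis
      by (simp add: A)
  qed
  moreover have "a ^ i * b ^ j \<in> span F" for i j
    by (rule mult_in_span[OF m n]) (auto simp: F_def intro!: span_base)
  then have "A \<subseteq> span F"
    by (auto simp: A_def)
  moreover have "1 \<in> A"
    using A[of 0 0] by simp
  moreover have "finite F"
    by (simp add: F_def)
  ultimately obtain B where B: "subalgebra_basis B" "span B = span A"
    using subalgebra_basis_exists by blast
  have "a \<in> span A" "b \<in> span A"
    using A[of 1 0] A[of 0 1] by (simp_all add: span_base)
  with B show thesis
    using that by simp
qed

lemma power_basis_exists:
  obtains B where "subalgebra_basis B" "span B = span (range (\<lambda>i. a ^ i))"
proof -
  obtain n where n: "\<And>k. a ^ k \<in> span ((\<lambda>i. a ^ i) ` {..<n})"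
    using powers_in_finite_span by blast
  show thesis
  proof (rule subalgebra_basis_exists[of "range (\<lambda>i. a ^ i)" "(\<lambda>i. a ^ i) ` {..<n}"])
    show "1 \<in> range (\<lambda>i. a ^ i)"
      by (rule range_eqI[of _ _ 0]) simp
    fix x y assume "x \<in> range (\<lambda>i. a ^ i)" "y \<in> range (\<lambda>i. a ^ i)"
    then obtain i j where "x = a ^ i" "y = a ^ j"
      by blast
    then show "x * y \<in> range (\<lambda>i. a ^ i)"
      by (simp flip: power_add)
  next
    show "range (\<lambda>i. a ^ i) \<subseteq> span ((\<lambda>i. a ^ i) ` {..<n})"
      using n by blast
  qed (use that in auto)
qed

text \<open>Multiplication by a nonzero \<open>x\<close> is injective on the finite-dimensional
  \<open>span B\<close>, hence surjective, so it hits \<open>1\<close>.\<close>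

lemma inverse_in_span:
  assumes B: "subalgebra_basis B" and x: "x \<in> span B" "x \<noteq> 0"
  shows "inverse x \<in> span B"
proof -
  interpret mult: Vector_Spaces.linear scal scal "(*) x"
    by (rule linear_mult)
  have fin: "finite B" and indep: "independent B"
    using B by (simp_all add: subalgebra_basis_def)
  have "inj ((*) x)"
    using x by (auto intro: injI)
  then have indep': "independent ((*) x ` B)"
    by (intro mult.independent_injective_image[OF indep]) (simp add: x inj_on_def)
  have sub: "(*) x ` B \<subseteq> span B"
    using B x by (auto simp: subalgebra_basis_def span_base)
  have "1 \<in> span ((*) x ` B)"
  proof (rule ccontr)
    \<comment> \<open>Otherwise adjoining \<open>1\<close> to the multiples \<open>x * b\<close>
      would give \<open>Suc (card B)\<close> independent vectors in a space of dimension
      \<open>card B\<close>.\<close>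
    assume *: "1 \<notin> span ((*) x ` B)"
    then have "1 \<notin> (*) x ` B"
      using span_base by blast
    then have "card (insert 1 ((*) x ` B)) = Suc (card B)"
      using fin card_image[OF inj_on_subset[OF \<open>inj ((*) x)\<close>, of B]] by simp
    moreover have "independent (insert 1 ((*) x ` B))"
      using * indep' by (rule independent_insertI)
    moreover have "insert 1 ((*) x ` B) \<subseteq> span B"
      using sub B by (auto simp: subalgebra_basis_def)
    ultimately show False
      using independent_span_bound[OF fin] by fastforce
  qed
  then obtain y where "y \<in> span B" "x * y = 1"
    by (auto simp: mult.span_image)
  then show ?thesis
    using inverse_unique by metis
qed

section \<open>Traces of multiplication maps\<close>

text \<open>Meaningful only if \<open>span B\<close> is stable under multiplication by \<open>a\<close>, since
  \<open>representation B\<close> is \<open>0\<close> outside \<open>span B\<close>.\<close>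

definition trace :: "'b set \<Rightarrow> 'b \<Rightarrow> 'a" where
  "trace B a = (\<Sum>b\<in>B. representation B (a * b) b)"

text \<open>This is tr(MN) = tr(NM), where M holds the coordinates of each \<open>b\<close> in the
  basis \<open>C\<close> and N those of each \<open>a * c\<close> in the basis \<open>B\<close>.
  Both traces equal one double sum over \<open>B\<close> and \<open>C\<close>.\<close>

lemma trace_basis_independent:
  assumes B: "finite B" "independent B" and C: "finite C" "independent C"
    and span: "span B = span C" and a: "\<And>c. c \<in> C \<Longrightarrow> a * c \<in> span C"
  shows "trace B a = trace C a"
proof -
  have bC: "b \<in> span C" if "b \<in> B" for b
    using that span span_base by blast
  have "representation B (a * b) b = (\<Sum>c\<in>C. representation C b c * representation B (a * c) b)"
    if "b \<in> B" for b
  proof -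
    have "a * b = a * (\<Sum>c\<in>C. representation C b c \<cdot> c)"
      using sum_representation_eq[OF C(2) bC[OF that] C(1)] by simp
    also have "\<dots> = (\<Sum>c\<in>C. representation C b c \<cdot> (a * c))"
      by (simp add: sum_distrib_left mult_scal_right)
    finally show ?thesis
      by (simp add: representation_sum representation_scale B a span span_scale)
  qed
  then have "trace B a = (\<Sum>b\<in>B. \<Sum>c\<in>C. representation C b c * representation B (a * c) b)"
    by (simp add: trace_def)
  also have "\<dots> = (\<Sum>c\<in>C. \<Sum>b\<in>B. representation B (a * c) b * representation C b c)"
    by (subst sum.swap) (simp add: mult.commute)
  also have "\<dots> = trace C a"
    unfolding trace_def
  proof (rule sum.cong[OF refl])
    fix c assume "c \<in> C"
    have "a * c = (\<Sum>b\<in>B. representation B (a * c) b \<cdot> b)"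
      using sum_representation_eq[OF B(2) _ B(1)] a[OF \<open>c \<in> C\<close>] span by simp
    then have "representation C (a * c) = representation C (\<Sum>b\<in>B. representation B (a * c) b \<cdot> b)"
      by simp
    then show "(\<Sum>b\<in>B. representation B (a * c) b * representation C b c) = representation C (a * c) c"
      by (simp add: representation_sum representation_scale C bC span_scale)
  qed
  finally show ?thesis .
qed

section \<open>Bases over an intermediate field and traces in towers\<close>

text \<open>Linear independence of \<open>W\<close> over \<open>span B\<close>: the coefficients lie
  in the large field, whereas \<open>independent\<close> takes them from the base. The sum is
  meaningful for finite \<open>W\<close>, which every use supplies.\<close>

definition free_over :: "'b set \<Rightarrow> 'b set \<Rightarrow> bool" where
  "free_over B W \<longleftrightarrow>
     (\<forall>l. (\<forall>w\<in>W. l w \<in> span B) \<longrightarrow> (\<Sum>w\<in>W. l w * w) = 0 \<longrightarrow> (\<forall>w\<in>W. l w = 0))"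

lemma free_over_products:
  assumes B: "finite B" "independent B" and W: "finite W" "free_over B W"
  shows "inj_on (\<lambda>(e, w). e * w) (B \<times> W)"
    and "independent ((\<lambda>(e, w). e * w) ` (B \<times> W))"
proof -
  \<comment> \<open>Collecting terms with equal \<open>w\<close> gives a relation with coefficients
    in \<open>span B\<close>. Freeness kills these, and independence of \<open>B\<close> then kills
    their coordinates. Indexing by pairs makes this usable before injectivity is known.\<close>
  have coeffs: "u (e, w) = 0"
    if "(\<Sum>(e, w)\<in>B \<times> W. u (e, w) \<cdot> (e * w)) = 0" "e \<in> B" "w \<in> W" for u e w
  proof -
    define l where "l w = (\<Sum>e\<in>B. u (e, w) \<cdot> e)" for w
    have "l w \<in> span B" for w
      unfolding l_def by (intro span_sum span_scale span_base)
    moreover have "(\<Sum>w\<in>W. l w * w) = (\<Sum>w\<in>W. \<Sum>e\<in>B. u (e, w) \<cdot> (e * w))"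
      by (simp add: l_def sum_distrib_right mult_scal_left)
    moreover have "\<dots> = (\<Sum>(e, w)\<in>B \<times> W. u (e, w) \<cdot> (e * w))"
      by (subst sum.swap) (simp add: sum.cartesian_product)
    ultimately have "l w = 0"
      using W(2) that by (auto simp: free_over_def)
    then show ?thesis
      using B \<open>e \<in> B\<close> independentD[of B B "\<lambda>e. u (e, w)" e] by (simp add: l_def)
  qed
  show inj: "inj_on (\<lambda>(e, w). e * w) (B \<times> W)"
  proof (rule inj_onI, rule ccontr)
    fix p q assume pq: "p \<in> B \<times> W" "q \<in> B \<times> W" "p \<noteq> q"
      and eq: "(case p of (e, w) \<Rightarrow> e * w) = (case q of (e, w) \<Rightarrow> e * w)"
    \<comment> \<open>Two pairs with the same product give a nontrivial relation, with coefficients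
      1 at \<open>p\<close> and -1 at \<open>q\<close>.\<close>
    define u :: "'b \<times> 'b \<Rightarrow> 'a" where "u x = (if x = p then 1 else 0) - (if x = q then 1 else 0)" for x
    have "(\<Sum>(e, w)\<in>B \<times> W. u (e, w) \<cdot> (e * w)) = (\<Sum>x\<in>B \<times> W. u x \<cdot> (fst x * snd x))"
      by (simp add: case_prod_unfold)
    also have "\<dots> = (\<Sum>x\<in>B \<times> W. if x = p then fst x * snd x else 0)
                  - (\<Sum>x\<in>B \<times> W. if x = q then fst x * snd x else 0)"
      unfolding sum_subtractf[symmetric]
      by (rule sum.cong) (auto simp: u_def scale_left_diff_distrib)
    also have "\<dots> = 0"
      using pq eq B W by (simp add: case_prod_unfold)
    finally have "u (fst p, snd p) = 0"
      by (rule coeffs) (use pq in auto)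
    then show False
      using pq by (simp add: u_def)
  qed
  show "independent ((\<lambda>(e, w). e * w) ` (B \<times> W))"
  proof (rule independent_if_scalars_zero)
    fix f x
    assume "(\<Sum>x\<in>(\<lambda>(e, w). e * w) ` (B \<times> W). f x \<cdot> x) = 0"
      and x: "x \<in> (\<lambda>(e, w). e * w) ` (B \<times> W)"
    then have "(\<Sum>(e, w)\<in>B \<times> W. f (e * w) \<cdot> (e * w)) = 0"
      by (subst (asm) sum.reindex[OF inj]) (simp add: case_prod_unfold)
    then show "f x = 0"
      using coeffs[of "\<lambda>(e, w). f (e * w)"] x by auto
  qed (use B W in simp)
qed

text \<open>A free set \<open>W\<close> of maximal cardinality in \<open>span C\<close> is a basis
  over the field \<open>span B\<close>. The maximum exists because the products \<open>e * w\<close>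
  are independent over the base, which forces \<open>card W\<close> to be at most
  \<open>card C\<close>.\<close>

lemma free_basis_exists:
  assumes B: "subalgebra_basis B" and C: "finite C"
    and stable: "\<And>x c. x \<in> B \<Longrightarrow> c \<in> C \<Longrightarrow> x * c \<in> span C"
  obtains W where "finite W" "free_over B W" "span ((\<lambda>(e, w). e * w) ` (B \<times> W)) = span C"
proof -
  have finB: "finite B" and indB: "independent B" and oneB: "1 \<in> span B"
    and multB: "\<And>x y. x \<in> span B \<Longrightarrow> y \<in> span B \<Longrightarrow> x * y \<in> span B"
    using B by (auto simp: subalgebra_basis_def)
  have prod_sub: "(\<lambda>(e, w). e * w) ` (B \<times> W) \<subseteq> span C" if "W \<subseteq> span C" for W
    using that by (auto intro: mult_in_span[OF span_base _ stable])
  define P where "P W \<longleftrightarrow> finite W \<and> W \<subseteq> span C \<and> free_over B W" for W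
  have "P {}"
    by (simp add: P_def free_over_def)
  moreover have "card W \<le> card C" if "P W" for W
  proof -
    have W: "finite W" "W \<subseteq> span C" "free_over B W"
      using that by (auto simp: P_def)
    note products = free_over_products[OF finB indB W(1,3)]
    have "card W \<le> card B * card W"
      using card_subalgebra_basis[OF B] by simp
    also have "\<dots> = card ((\<lambda>(e, w). e * w) ` (B \<times> W))"
      using card_image[OF products(1)] by (simp add: card_cartesian_product)
    also have "\<dots> \<le> card C"
      using independent_span_bound[OF C products(2) prod_sub[OF W(2)]] by simp
    finally show ?thesis .
  qed
  ultimately obtain W where W: "P W" and max: "\<And>W'. P W' \<Longrightarrow> card W' \<le> card W"
    using ex_has_greatest_nat[of P "{}" card "Suc (card C)"] by (metis le_imp_less_Suc)
  have finW: "finite W" and subW: "W \<subseteq> span C" and freeW: "free_over B W"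
    using W by (auto simp: P_def)
  let ?S = "span ((\<lambda>(e, w). e * w) ` (B \<times> W))"
  have mult_S: "x * w \<in> ?S" if "x \<in> span B" "w \<in> W" for x w
    by (rule mult_in_span[of x B w "{w}"]) (use that in \<open>auto intro!: span_base\<close>)
  have "v \<in> ?S" if v: "v \<in> span C" for v
  proof (cases "v \<in> W")
    case True
    then show ?thesis
      using mult_S[OF oneB True] by simp
  next
    case False
    then have "\<not> P (insert v W)"
      using max[of "insert v W"] finW by auto
    then have "\<not> free_over B (insert v W)"
      using v finW subW by (simp add: P_def)
    then obtain l where l: "\<And>w. w \<in> insert v W \<Longrightarrow> l w \<in> span B"
      and sum: "l v * v + (\<Sum>w\<in>W. l w * w) = 0" and nz: "\<exists>w\<in>insert v W. l w \<noteq> 0"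
      using finW False by (auto simp: free_over_def)
    \<comment> \<open>With a zero coefficient at \<open>v\<close> the relation would contradict
      freeness of \<open>W\<close>. Being nonzero, the coefficient is invertible inside
      \<open>span B\<close>, and the relation can be solved for \<open>v\<close>.\<close>
    have "l v \<noteq> 0"
    proof
      assume "l v = 0"
      with sum l nz freeW show False
        by (auto simp: free_over_def)
    qed
    have "v = (\<Sum>w\<in>W. - (inverse (l v) * l w * w))"
    proof -
      have "l v * v = - (\<Sum>w\<in>W. l w * w)"
        using sum by (simp add: eq_neg_iff_add_eq_0)
      then have "inverse (l v) * (l v * v) = - (inverse (l v) * (\<Sum>w\<in>W. l w * w))"
        by simp
      then show ?thesis
        using \<open>l v \<noteq> 0\<close> by (simp add: sum_distrib_left sum_negf mult.assoc[symmetric])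
    qed
    also have "\<dots> \<in> ?S"
      using l \<open>l v \<noteq> 0\<close> by (intro span_sum span_neg mult_S multB inverse_in_span[OF B]) auto
    finally show ?thesis .
  qed
  then have "span C \<subseteq> ?S"
    by blast
  moreover have "?S \<subseteq> span C"
    using prod_sub[OF subW] by (simp add: span_minimal)
  ultimately show thesis
    using that finW freeW by blast
qed

text \<open>In the basis of products, multiplication by \<open>a\<close> is block diagonal: each
  \<open>w\<close> contributes one copy of the matrix of \<open>a\<close> on
  \<open>B\<close>.\<close>

lemma trace_products:
  assumes B: "subalgebra_basis B" and W: "finite W" "free_over B W" and a: "a \<in> span B"
  shows "trace ((\<lambda>(e, w). e * w) ` (B \<times> W)) a = of_nat (card W) * trace B a"
proof -
  let ?A = "(\<lambda>(e, w). e * w) ` (B \<times> W)"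
  have finB: "finite B" and indB: "independent B"
    using B by (simp_all add: subalgebra_basis_def)
  note products = free_over_products[OF finB indB W]
  have "representation ?A (a * (e * w)) (e * w) = representation B (a * e) e"
    if ew: "e \<in> B" "w \<in> W" for e w
  proof -
    have "a * e \<in> span B"
      using B a ew by (simp add: subalgebra_basis_def span_base)
    then have "a * e = (\<Sum>x\<in>B. representation B (a * e) x \<cdot> x)"
      using sum_representation_eq[OF indB _ finB] by simp
    then have "a * (e * w) = (\<Sum>x\<in>B. representation B (a * e) x \<cdot> (x * w))"
      by (metis (no_types, lifting) mult.assoc mult_scal_left sum.cong sum_distrib_right)
    moreover have mem: "x * w \<in> ?A" if "x \<in> B" for x
      using that ew by auto
    ultimately have "representation ?A (a * (e * w)) (e * w) =
        (\<Sum>x\<in>B. representation B (a * e) x * representation ?A (x * w) (e * w))"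
      by (simp add: representation_sum representation_scale products span_scale span_base)
    also have "\<dots> = (\<Sum>x\<in>B. if x = e then representation B (a * e) x else 0)"
    proof (rule sum.cong[OF refl])
      fix x assume "x \<in> B"
      have "x * w = e * w \<longleftrightarrow> x = e"
        using inj_onD[OF products(1), of "(x, w)" "(e, w)"] \<open>x \<in> B\<close> ew by auto
      then show "representation B (a * e) x * representation ?A (x * w) (e * w) =
          (if x = e then representation B (a * e) x else 0)"
        using representation_basis[OF products(2) mem[OF \<open>x \<in> B\<close>]] by auto
    qed
    also have "\<dots> = representation B (a * e) e"
      using finB ew by simp
    finally show ?thesis .
  qed
  then have "trace ?A a = (\<Sum>(e, w)\<in>B \<times> W. representation B (a * e) e)"
    unfolding trace_def by (subst sum.reindex[OF products(1)]) (auto intro!: sum.cong)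
  also have "\<dots> = of_nat (card W) * trace B a"
    by (simp add: trace_def sum.cartesian_product[symmetric] sum_distrib_left)
  finally show ?thesis .
qed

text \<open>For a basis \<open>W\<close> of \<open>span C\<close> over \<open>span B\<close>, the
  trace gains the factor \<open>card W\<close>, and \<open>card C\<close> is
  \<open>card B * card W\<close>. The cross-multiplied form avoids division, and
  \<open>span C\<close> may be any \<open>span B\<close>-module rather than an algebra.\<close>

lemma trace_tower:
  assumes B: "subalgebra_basis B" and C: "finite C" "independent C"
    and stable: "\<And>x c. x \<in> B \<Longrightarrow> c \<in> C \<Longrightarrow> x * c \<in> span C" and a: "a \<in> span B"
  shows "of_nat (card B) * trace C a = of_nat (card C) * trace B a"
proof -
  have finB: "finite B" and indB: "independent B"
    using B by (simp_all add: subalgebra_basis_def)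
  obtain W where W: "finite W" "free_over B W"
    and span: "span ((\<lambda>(e, w). e * w) ` (B \<times> W)) = span C"
    using free_basis_exists[OF B C(1) stable] by blast
  let ?A = "(\<lambda>(e, w). e * w) ` (B \<times> W)"
  note products = free_over_products[OF finB indB W]
  have finA: "finite ?A"
    using finB W by simp
  have "card ?A = card B * card W"
    using card_image[OF products(1)] by (simp add: card_cartesian_product)
  moreover have "card ?A = card C"
    using span dim_span_eq_card_independent[OF products(2)] dim_span_eq_card_independent[OF C(2)]
    by simp
  moreover have "a * c \<in> span C" if "c \<in> C" for c
    by (rule mult_in_span[OF a, of c "{c}"]) (use that stable in \<open>auto simp: span_base\<close>)
  then have "trace ?A a = trace C a"
    by (rule trace_basis_independent[OF finA products(2) C span])
  ultimately show ?thesis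
    using trace_products[OF B W a] by (metis of_nat_mult mult.assoc)
qed

section \<open>The normalized trace\<close>

text \<open>The span of the powers of \<open>a\<close> lies in every subalgebra containing
  \<open>a\<close>, so this choice can be compared with any other.\<close>

definition ntrace :: "'b \<Rightarrow> 'a" where
  "ntrace a = (let B = SOME B. subalgebra_basis B \<and> span B = span (range (\<lambda>i. a ^ i))
               in trace B a / of_nat (card B))"

text \<open>\<open>trace_tower\<close> compares the chosen basis with \<open>C\<close>;
  characteristic 0 makes both degrees invertible.\<close>

lemma ntrace_eq:
  assumes C: "subalgebra_basis C" and a: "a \<in> span C"
  shows "ntrace a = trace C a / of_nat (card C)"
proof -
  define B where "B = (SOME B. subalgebra_basis B \<and> span B = span (range (\<lambda>i. a ^ i)))"
  have "\<exists>B. subalgebra_basis B \<and> span B = span (range (\<lambda>i. a ^ i))"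
    using power_basis_exists by metis
  then have B: "subalgebra_basis B" and span: "span B = span (range (\<lambda>i. a ^ i))"
    unfolding B_def by (rule someI2_ex; blast)+
  have "a ^ i \<in> span C" for i
    by (induction i) (use C a in \<open>auto simp: subalgebra_basis_def\<close>)
  then have "span B \<subseteq> span C"
    unfolding span by (intro span_minimal) auto
  then have "x * c \<in> span C" if "x \<in> B" "c \<in> C" for x c
    using C that by (auto simp: subalgebra_basis_def span_base subset_iff)
  moreover have "a \<in> span B"
    unfolding span by (intro span_base range_eqI[of _ _ 1]) simp
  ultimately have "of_nat (card B) * trace C a = of_nat (card C) * trace B a"
    using C by (intro trace_tower[OF B]) (auto simp: subalgebra_basis_def)
  then have "trace B a / of_nat (card B) = trace C a / of_nat (card C)"
    using card_subalgebra_basis[OF B] card_subalgebra_basis[OF C]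
    by (simp add: of_nat_neq_0 field_simps)
  then show ?thesis
    by (simp add: ntrace_def B_def Let_def)
qed

text \<open>All three values are computed in one subalgebra, where the trace is additive and the
  degree is shared.\<close>

lemma ntrace_add: "ntrace (a + b) = ntrace a + ntrace b"
proof -
  obtain B where B: "subalgebra_basis B" and a: "a \<in> span B" and b: "b \<in> span B"
    using subalgebra_basis_exists_containing by blast
  have "representation B ((a + b) * x) x = representation B (a * x) x + representation B (b * x) x"
    if "x \<in> B" for x
    using B a b that by (simp add: subalgebra_basis_def ring_distribs representation_add span_base)
  then have "trace B (a + b) = trace B a + trace B b"
    by (simp add: trace_def sum.distrib)
  then show ?thesis
    using ntrace_eq[OF B] a b by (simp add: span_add add_divide_distrib)
qed

lemma ntrace_diff: "ntrace (a - b) = ntrace a - ntrace b"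
  using ntrace_add[of "a - b" b] by (simp add: eq_diff_eq)

text \<open>Base elements lie in the one-dimensional algebra \<open>span {1}\<close>, where each is
  its own trace.\<close>

lemma ntrace_hom: "ntrace (h k) = k"
proof -
  have B: "subalgebra_basis {1}"
    by (auto simp: subalgebra_basis_def span_singleton scal_def hom_1 simp flip: hom_mult
        intro: range_eqI[of _ _ 1])
  have "h k = k \<cdot> 1"
    by (simp add: scal_def)
  then have "h k \<in> span {1}" "representation {1} (h k * 1) 1 = k"
    by (simp_all add: span_scale span_base representation_scale representation_basis)
  then show ?thesis
    using ntrace_eq[OF B] by (simp add: trace_def)
qed

text \<open>The image of \<open>B\<close> under \<tau> is again a subalgebra basis, of the same
  size, and the matrix of \<open>\<tau> a\<close> in it arises by applying \<sigma> to every entry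
  of the matrix of \<open>a\<close>. The subalgebra need not be stable under \<tau>, because
  \<open>ntrace_eq\<close> permits different bases on the two sides.\<close>

lemma ntrace_semilinear:
  assumes \<sigma>: "bij \<sigma>" "\<And>x y. \<sigma> (x + y) = \<sigma> x + \<sigma> y" "\<And>x y. \<sigma> (x * y) = \<sigma> x * \<sigma> y" "\<sigma> 1 = 1"
    and \<tau>: "bij \<tau>" "\<And>x y. \<tau> (x + y) = \<tau> x + \<tau> y" "\<And>x y. \<tau> (x * y) = \<tau> x * \<tau> y" "\<tau> 1 = 1"
    and compat: "\<And>k. \<tau> (h k) = h (\<sigma> k)"
  shows "ntrace (\<tau> a) = \<sigma> (ntrace a)"
proof -
  obtain B where B: "subalgebra_basis B" and a: "a \<in> span B"
    using subalgebra_basis_exists_containing by blast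
  have finB: "finite B" and indB: "independent B"
    using B by (simp_all add: subalgebra_basis_def)
  have injt: "inj \<tau>"
    using \<tau>(1) by (rule bij_is_inj)
  have \<sigma>0: "\<sigma> 0 = 0" and \<tau>0: "\<tau> 0 = 0"
    by (metis add_cancel_right_left \<sigma>(2)) (metis add_cancel_right_left \<tau>(2))
  have \<sigma>_sum: "\<sigma> (sum f A) = (\<Sum>x\<in>A. \<sigma> (f x))" for f :: "'b \<Rightarrow> 'a" and A
    by (induction A rule: infinite_finite_induct) (simp_all add: \<sigma>0 \<sigma>)
  have \<tau>_sum: "\<tau> (sum f A) = (\<Sum>x\<in>A. \<tau> (f x))" for f :: "'b \<Rightarrow> 'b" and A
    by (induction A rule: infinite_finite_induct) (simp_all add: \<tau>0 \<tau>)
  have \<sigma>_of_nat: "\<sigma> (of_nat n) = of_nat n" for n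
    by (induction n) (simp_all add: \<sigma>0 \<sigma>)
  have \<sigma>_divide: "\<sigma> (x / of_nat n) = \<sigma> x / of_nat n" if "n \<noteq> 0" for x n
  proof -
    have "\<sigma> (x / of_nat n) * of_nat n = \<sigma> (x / of_nat n * of_nat n)"
      by (simp only: \<sigma>(3) \<sigma>_of_nat)
    then show ?thesis
      using that by (simp add: of_nat_neq_0 eq_divide_eq)
  qed
  have \<tau>_scal: "\<tau> (c \<cdot> x) = \<sigma> c \<cdot> \<tau> x" for c x
    by (simp add: scal_def \<tau> compat)
  have \<tau>_span: "\<tau> x \<in> span (\<tau> ` B)" if "x \<in> span B" for x
    using that
    by (induction rule: span_induct_alt)
       (simp_all add: \<tau>0 \<tau> \<tau>_scal span_zero span_add span_scale span_base)
  have span_\<tau>: "span (\<tau> ` B) \<subseteq> \<tau> ` span B"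
  proof
    fix y assume "y \<in> span (\<tau> ` B)"
    then show "y \<in> \<tau> ` span B"
    proof (induction rule: span_induct_alt)
      case base
      show ?case
        by (rule image_eqI[of _ _ 0]) (simp_all add: \<tau>0 span_zero)
    next
      case (step c x y)
      then obtain b z where "b \<in> B" "x = \<tau> b" "z \<in> span B" "y = \<tau> z"
        by blast
      \<comment> \<open>Scalars over the image basis are arbitrary; surjectivity of \<sigma> pulls
        them back.\<close>
      moreover obtain d where "c = \<sigma> d"
        using \<sigma>(1) by (meson bij_pointE)
      ultimately show ?case
        by (intro image_eqI[of _ _ "d \<cdot> b + z"])
           (simp_all add: \<tau> \<tau>_scal span_add span_scale span_base)
    qed
  qed
  have ind: "independent (\<tau> ` B)"
  proof (rule independent_if_scalars_zero)
    fix f x assume sum: "(\<Sum>x\<in>\<tau> ` B. f x \<cdot> x) = 0" and x: "x \<in> \<tau> ` B"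
    have "\<exists>k. f y = \<sigma> k" for y
      using \<sigma>(1) by (meson bij_pointE)
    \<comment> \<open>With its coefficients written as values of \<sigma>, a relation among the
      images is the \<tau>-image of a relation in \<open>B\<close>.\<close>
    then obtain g where f: "\<And>y. f y = \<sigma> (g y)"
      by metis
    have "\<tau> (\<Sum>b\<in>B. g (\<tau> b) \<cdot> b) = (\<Sum>b\<in>B. f (\<tau> b) \<cdot> \<tau> b)"
      by (simp add: \<tau>_sum \<tau>_scal flip: f)
    also have "\<dots> = \<tau> 0"
      using sum by (simp add: sum.reindex[OF inj_on_subset[OF injt subset_UNIV]] \<tau>0)
    finally have "(\<Sum>b\<in>B. g (\<tau> b) \<cdot> b) = 0"
      using injt by (simp add: inj_eq)
    then have "g (\<tau> b) = 0" if "b \<in> B" for b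
      using independentD[OF indB finB, of "\<lambda>b. g (\<tau> b)" b] that by simp
    then show "f x = 0"
      using x f \<sigma>0 by (metis imageE)
  qed (use finB in simp)
  have basis: "subalgebra_basis (\<tau> ` B)"
    unfolding subalgebra_basis_def
  proof (intro conjI ballI)
    show "1 \<in> span (\<tau> ` B)"
      using \<tau>_span[of 1] B by (simp add: subalgebra_basis_def \<tau>)
    fix x y assume "x \<in> span (\<tau> ` B)" "y \<in> span (\<tau> ` B)"
    then obtain x' y' where "x = \<tau> x'" "y = \<tau> y'" "x' \<in> span B" "y' \<in> span B"
      using span_\<tau> by blast
    then show "x * y \<in> span (\<tau> ` B)"
      using \<tau>_span[of "x' * y'"] B by (simp add: subalgebra_basis_def \<tau>)
  qed (use finB ind in auto)
  have rep: "representation (\<tau> ` B) (\<tau> x) (\<tau> b) = \<sigma> (representation B x b)"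
    if "x \<in> span B" "b \<in> B" for x b
  proof -
    have "\<tau> x = \<tau> (\<Sum>e\<in>B. representation B x e \<cdot> e)"
      using sum_representation_eq[OF indB that(1) finB] by simp
    also have "\<dots> = (\<Sum>e\<in>B. \<sigma> (representation B x e) \<cdot> \<tau> e)"
      by (simp add: \<tau>_sum \<tau>_scal)
    finally have "representation (\<tau> ` B) (\<tau> x) (\<tau> b) =
        (\<Sum>e\<in>B. \<sigma> (representation B x e) * representation (\<tau> ` B) (\<tau> e) (\<tau> b))"
      by (simp add: representation_sum representation_scale ind span_scale span_base)
    also have "\<dots> = (\<Sum>e\<in>B. if e = b then \<sigma> (representation B x e) else 0)"
      using injt by (intro sum.cong) (auto simp: representation_basis ind inj_eq)
    also have "\<dots> = \<sigma> (representation B x b)"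
      using finB that by simp
    finally show ?thesis .
  qed
  have "trace (\<tau> ` B) (\<tau> a) = (\<Sum>b\<in>B. representation (\<tau> ` B) (\<tau> (a * b)) (\<tau> b))"
    by (simp add: trace_def sum.reindex[OF inj_on_subset[OF injt subset_UNIV]] \<tau>)
  also have "\<dots> = (\<Sum>b\<in>B. \<sigma> (representation B (a * b) b))"
    using B a by (intro sum.cong rep) (auto simp: subalgebra_basis_def span_base)
  also have "\<dots> = \<sigma> (trace B a)"
    by (simp add: trace_def \<sigma>_sum)
  finally have "trace (\<tau> ` B) (\<tau> a) = \<sigma> (trace B a)" .
  moreover have "card (\<tau> ` B) = card B"
    by (rule card_image[OF inj_on_subset[OF injt subset_UNIV]])
  ultimately show ?thesis
    using ntrace_eq[OF basis \<tau>_span[OF a]] ntrace_eq[OF B a] card_subalgebra_basis[OF B]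
    by (simp add: \<sigma>_divide)
qed

end

section \<open>Application to the rational function field\<close>

text \<open>Injectivity of \<open>to_fract\<close> preserves the vanishing of integers. As a simp
  rule this supplies characteristic 0 for \<open>ratfun2\<close>.\<close>

lemma CHAR_fract [simp]: "CHAR('a :: idom fract) = CHAR('a)"
proof -
  have of_nat: "of_nat n = to_fract (of_nat n :: 'a)" for n
    by (induction n) simp_all
  show ?thesis
    by (rule CHAR_eqI) (simp_all add: of_nat of_nat_eq_0_iff_char_dvd)
qed

theorem theorem3p2:
  fixes \<phi> \<psi> :: "'k :: {alg_closed_field, field_char_0} ratfun2 \<Rightarrow> 'k ratfun2"
    and \<phi>' \<psi>' :: "'k ratfun2 alg_closure \<Rightarrow> 'k ratfun2 alg_closure"
    and f :: "'k ratfun2"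
  assumes "\<phi> \<in> const_field_auts" and "\<psi> \<in> const_field_auts"
    and "\<phi>' \<in> ac_extensions \<phi>" and "\<psi>' \<in> ac_extensions \<psi>"
  shows "(\<exists>g h. to_ac f = \<phi>' g - g + \<psi>' h - h) \<longleftrightarrow> (\<exists>g h. f = \<phi> g - g + \<psi> h - h)"
proof
  interpret algebraic_extension "to_ac :: 'k ratfun2 \<Rightarrow> _"
  proof
    show "\<exists>p. p \<noteq> 0 \<and> poly (map_poly to_ac p) z = 0" for z :: "'k ratfun2 alg_closure"
      by (metis alg_closure_algebraic)
  qed simp_all
  \<comment> \<open>A single map \<open>ntrace\<close> intertwines both automorphisms with their
    extensions, so no finite extension stable under both has to be found.\<close>
  have equivariant: "ntrace (\<tau> a) = \<sigma> (ntrace a)"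
    if "\<sigma> \<in> const_field_auts" "\<tau> \<in> ac_extensions \<sigma>" for \<sigma> \<tau> a
    using that by (intro ntrace_semilinear)
      (auto simp: const_field_auts_def ac_extensions_def field_auts_iff)
  assume "\<exists>g h. to_ac f = \<phi>' g - g + \<psi>' h - h"
  then obtain g h where "to_ac f = \<phi>' g - g + \<psi>' h - h"
    by blast
  then have "ntrace (to_ac f) = ntrace (\<phi>' g - g + \<psi>' h - h)"
    by simp
  \<comment> \<open>The rational witnesses are the normalized traces of the algebraic ones.\<close>
  then have "f = \<phi> (ntrace g) - ntrace g + \<psi> (ntrace h) - ntrace h"
    by (simp add: ntrace_hom ntrace_diff ntrace_add equivariant[OF assms(1,3)]
          equivariant[OF assms(2,4)])
  then show "\<exists>g h. f = \<phi> g - g + \<psi> h - h"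
    by blast
next
  assume "\<exists>g h. f = \<phi> g - g + \<psi> h - h"
  then obtain g h where "f = \<phi> g - g + \<psi> h - h"
    by blast
  then have "to_ac f = \<phi>' (to_ac g) - to_ac g + \<psi>' (to_ac h) - to_ac h"
    using assms(3,4) by (simp add: ac_extensions_def)
  then show "\<exists>g h. to_ac f = \<phi>' g - g + \<psi>' h - h"
    by blast
qed

end
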